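(* Let $(X,\delta)$ be a bounded hyperconvex diversity and let $(H_i)_{i\in I}$ be a (decreasing) directed family of subsets of $X$, i.e. $(I,\le)$ is a nonempty directed set and $H_i\subseteq H_j$ whenever $j\le i$, such that $(H_i,\delta)$, i.e. $H_i$ with the restriction of $\delta$ to $\langle H_i\rangle$, is a hyperconvex diversity for each $i\in I$. Then $\bigcap_{i\in I}H_i\neq\emptyset$.
   Context: For a set $X$, $\langle X\rangle$ denotes the set of finite subsets of $X$. A diversity is a pair $(X,\delta)$ with $\delta\colon\langle X\rangle\to\mathbb{R}$ such that (1) $\delta(A)\ge 0$ for all $A\in\langle X\rangle$, and $\delta(A)=0$ if and only if $|A|\le 1$; (2) for all $A,B,C\in\langle X\rangle$ with $B\ne\emptyset$, $\delta(A\cup C)\le\delta(A\cup B)+\delta(B\cup C)$. The diversity is bounded if there is $M\ge 0$ with $\delta(A)\le M$ for every $A\in\langle X\rangle$. A diversity $(X,\delta)$ is hyperconvex if for every $r\colon\langle X\rangle\to\mathbb{R}$ with $r(\emptyset)=0$ and $\delta\left(\bigcup_{A\in\mathcal{A}}A\right)\le\sum_{A\in\mathcal{A}}r(A)$ for all finite $\mathcal{A}\subseteq\langle X\rangle$, there is $z\in X$ such that $\delta(\{z\}\cup Y)\le r(Y)$ for all finite $Y\subseteq X$. *)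

theory Defs
  imports Complex_Main
begin

text \<open>
  Diversities are given by a carrier \<open>X\<close> inside a type and a set function \<open>\<delta>\<close>. Every notion
  below looks at \<open>\<delta>\<close> only on \<open>Fpow X\<close>, the finite subsets of \<open>X\<close>, so that for \<open>H \<subseteq> X\<close>
  the pair \<open>H\<close>, \<open>\<delta>\<close> stands for \<open>H\<close> with the restriction of \<open>\<delta>\<close> to the finite subsets of \<open>H\<close>.
\<close>

definition diversity :: "'a set \<Rightarrow> ('a set \<Rightarrow> real) \<Rightarrow> bool" where
  "diversity X \<delta> \<longleftrightarrow>
    (\<forall>A \<in> Fpow X. 0 \<le> \<delta> A \<and> (\<delta> A = 0 \<longleftrightarrow> card A \<le> 1)) \<and>
    (\<forall>A \<in> Fpow X. \<forall>B \<in> Fpow X. \<forall>C \<in> Fpow X.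
       B \<noteq> {} \<longrightarrow> \<delta> (A \<union> C) \<le> \<delta> (A \<union> B) + \<delta> (B \<union> C))"

definition bounded_diversity :: "'a set \<Rightarrow> ('a set \<Rightarrow> real) \<Rightarrow> bool" where
  "bounded_diversity X \<delta> \<longleftrightarrow>
    diversity X \<delta> \<and> (\<exists>M \<ge> 0. \<forall>A \<in> Fpow X. \<delta> A \<le> M)"

text \<open>The empty diversity is not hyperconvex, since a point \<open>z \<in> X\<close> is required to exist.\<close>

definition hyperconvex_diversity :: "'a set \<Rightarrow> ('a set \<Rightarrow> real) \<Rightarrow> bool" where
  "hyperconvex_diversity X \<delta> \<longleftrightarrow>
    diversity X \<delta> \<and>
    (\<forall>r :: 'a set \<Rightarrow> real.
       r {} = 0 \<and> (\<forall>\<A>. finite \<A> \<and> \<A> \<subseteq> Fpow X \<longrightarrow> \<delta> (\<Union>\<A>) \<le> (\<Sum>A\<in>\<A>. r A)) \<longrightarrow>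
       (\<exists>z \<in> X. \<forall>Y \<in> Fpow X. \<delta> ({z} \<union> Y) \<le> r Y))"

text \<open>A nonempty directed set in the usual sense: a preorder (antisymmetry is not required) in
  which any two elements have an upper bound.\<close>

definition directed_set :: "'i set \<Rightarrow> ('i \<Rightarrow> 'i \<Rightarrow> bool) \<Rightarrow> bool" where
  "directed_set I le \<longleftrightarrow>
    I \<noteq> {} \<and> reflp_on I le \<and> transp_on I le \<and>
    (\<forall>i \<in> I. \<forall>j \<in> I. \<exists>k \<in> I. le i k \<and> le j k)"

end

theory Submission
  imports Defs
begin

text \<open>For a chain of hyperconvex sets, take a minimal monotone choice of nonempty admissible
  subsets \<open>A K \<subseteq> K\<close>, as in Baillon's theorem on hyperconvex metric spaces. By minimality, a ball
  with center in \<open>C\<close> that contains \<open>A C\<close> contains \<open>A K\<close> for every larger \<open>K\<close> of the chain, so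
  restricting each \<open>A K\<close> to the points within distance \<open>c\<close> of all of \<open>A K\<close> changes nothing as
  long as no restricted set is empty. Boundedness makes this possible with \<open>c\<close> smaller than the
  common diameter if that is positive, so every \<open>A K\<close> is the same single point. Since
  nonempty admissible subsets of hyperconvex sets are hyperconvex, the intersection of a chain is
  even hyperconvex, and directed families reduce to chains by an order-theoretic argument.\<close>

subsection \<open>Chains and directed families in complete lattices\<close>

text \<open>Zorn's lemma for the reversed order: a nonempty chain has its infimum as lower bound,
  and any element of \<open>\<G>\<close> bounds the empty chain. It is applied below to families of
  sets, ordered pointwise as functions.\<close>

lemma Zorn_Inf:
  fixes \<G> :: "'b::complete_lattice set"
  assumes "\<G> \<noteq> {}"
    and Inf_closed: "\<And>\<C>. \<C> \<subseteq> \<G> \<Longrightarrow> \<C> \<noteq> {} \<Longrightarrow> Complete_Partial_Order.chain (\<le>) \<C> \<Longrightarrow> Inf \<C> \<in> \<G>"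
  obtains m where "m \<in> \<G>" and "\<And>g. g \<in> \<G> \<Longrightarrow> g \<le> m \<Longrightarrow> g = m"
proof -
  have "\<exists>m\<in>\<G>. \<forall>a\<in>\<G>. a \<le> m \<longrightarrow> a = m"
  proof (rule predicate_Zorn)
    show "partial_order_on \<G> (relation_of (\<lambda>x y. y \<le> x) \<G>)"
      by (rule partial_order_on_relation_ofI) auto
    show "\<exists>u\<in>\<G>. \<forall>a\<in>\<C>. u \<le> a" if "\<C> \<in> Chains (relation_of (\<lambda>x y. y \<le> x) \<G>)" for \<C>
    proof (cases "\<C> = {}")
      case True
      with \<open>\<G> \<noteq> {}\<close> show ?thesis by auto
    next
      case False
      have "\<C> \<subseteq> \<G>"
        using that by (auto simp: Chains_def relation_of_def)
      moreover have "Complete_Partial_Order.chain (\<le>) \<C>"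
        using that by (auto simp: Chains_def relation_of_def intro!: chainI)
      ultimately have "Inf \<C> \<in> \<G>"
        using False Inf_closed by blast
      then show ?thesis
        by (blast intro: Inf_lower)
    qed
  qed
  then show ?thesis
    using that by blast
qed

section \<open>Directed sets and monotone choices of upper bounds\<close>

lemma directed_set_finite_upper_bound:
  assumes "directed_set I le" and "finite F" and "F \<subseteq> I"
  shows "\<exists>k\<in>I. \<forall>i\<in>F. le i k"
  using assms(2,3)
proof (induction F)
  case empty
  then show ?case
    using assms(1) by (auto simp: directed_set_def)
next
  case (insert j F)
  then obtain k where k: "k \<in> I" "\<forall>i\<in>F. le i k"
    by auto
  obtain l where l: "l \<in> I" "le j l" "le k l"
    using assms(1) insert.prems k(1) unfolding directed_set_def by blast
  have "\<forall>i\<in>insert j F. le i l"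
  proof
    fix i assume i: "i \<in> insert j F"
    have "transp_on I le"
      using assms(1) by (simp add: directed_set_def)
    then have "le i l" if "i \<in> F"
      using transp_onD[of I le i k l] that k l(1,3) insert.prems by blast
    with i l(2) show "le i l" by blast
  qed
  with l(1) show ?case by blast
qed

text \<open>Well-founded recursion along strict inclusion: the value at a finite \<open>F\<close> is
  an upper bound of \<open>F\<close> and of the finitely many values at proper subsets of
  \<open>F\<close>. This replaces the directed set by the finite subsets of \<open>I\<close>, where
  joins are unions.\<close>

lemma directed_set_upper_bound_selection:
  assumes "directed_set I le"
  obtains u where "\<And>F. F \<in> Fpow I \<Longrightarrow> u F \<in> I"
    and "\<And>F i. F \<in> Fpow I \<Longrightarrow> i \<in> F \<Longrightarrow> le i (u F)"
    and "\<And>F G. F \<in> Fpow I \<Longrightarrow> G \<subset> F \<Longrightarrow> le (u G) (u F)"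
proof -
  define P where "P u F k \<longleftrightarrow> (F \<in> Fpow I \<longrightarrow> k \<in> I \<and> (\<forall>i\<in>F. le i k) \<and> (\<forall>G. G \<subset> F \<longrightarrow> le (u G) k))"
    for u and F :: "'a set" and k
  have "\<exists>u. \<forall>F. P u F (u F)"
  proof (rule dependent_wf_choice[where R = finite_psubset])
    show "P u F k = P v F k" if *: "\<And>G. (G, F) \<in> finite_psubset \<Longrightarrow> u G = v G" for u v F k
    proof -
      have "u G = v G" if "F \<in> Fpow I" "G \<subset> F" for G
        using *[of G] that by (auto simp: finite_psubset_def Fpow_def)
      then show ?thesis
        unfolding P_def by (metis (no_types))
    qed
    show "\<exists>k. P u F k" if *: "\<And>G. (G, F) \<in> finite_psubset \<Longrightarrow> P u G (u G)" for F u
    proof (cases "F \<in> Fpow I")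
      case True
      have "finite (F \<union> u ` {G. G \<subset> F})"
        using True by (auto simp: Fpow_def intro!: finite_subset[of "{G. G \<subset> F}" "Pow F"])
      moreover have "F \<union> u ` {G. G \<subset> F} \<subseteq> I"
      proof -
        have "u G \<in> I" if "G \<subset> F" for G
          using *[of G] True that finite_subset[of G F]
          unfolding P_def finite_psubset_def Fpow_def by auto
        then show ?thesis
          using True by (auto simp: Fpow_def)
      qed
      ultimately obtain k where "k \<in> I" "\<forall>i\<in>F \<union> u ` {G. G \<subset> F}. le i k"
        using directed_set_finite_upper_bound[OF assms, of "F \<union> u ` {G. G \<subset> F}"] by auto
      then show ?thesis
        unfolding P_def by auto
    qed (simp add: P_def)
  qed simp
  then obtain u where "\<And>F. P u F (u F)"
    by blast
  then show ?thesis
    using that[of u] unfolding P_def by blast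
qed

text \<open>Closure under infima of chains already gives lower bounds of directed families: among the
  antitone families indexed by the finite subsets of \<open>I\<close>, a minimal one coincides with all its
  shifts \<open>F \<mapsto> f (F \<union> E)\<close>, hence is constant.\<close>

lemma directed_lower_bound:
  fixes \<H> :: "'b::complete_lattice set"
  assumes Inf_closed: "\<And>\<C>. \<C> \<subseteq> \<H> \<Longrightarrow> \<C> \<noteq> {} \<Longrightarrow> Complete_Partial_Order.chain (\<le>) \<C> \<Longrightarrow> Inf \<C> \<in> \<H>"
    and dir: "directed_set I le"
    and mem: "\<And>i. i \<in> I \<Longrightarrow> h i \<in> \<H>"
    and anti: "\<And>i j. i \<in> I \<Longrightarrow> j \<in> I \<Longrightarrow> le j i \<Longrightarrow> h i \<le> h j"
  obtains a where "a \<in> \<H>" and "\<And>i. i \<in> I \<Longrightarrow> a \<le> h i"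
proof -
  obtain u where u_mem: "\<And>F. F \<in> Fpow I \<Longrightarrow> u F \<in> I"
    and u_ub: "\<And>F i. F \<in> Fpow I \<Longrightarrow> i \<in> F \<Longrightarrow> le i (u F)"
    and u_mono: "\<And>F G. F \<in> Fpow I \<Longrightarrow> G \<subset> F \<Longrightarrow> le (u G) (u F)"
    using directed_set_upper_bound_selection[OF dir] by blast
  define \<G> where "\<G> = {f. (\<forall>F\<in>Fpow I. f F \<in> \<H> \<and> f F \<le> h (u F)) \<and>
    (\<forall>F\<in>Fpow I. \<forall>G\<in>Fpow I. G \<subseteq> F \<longrightarrow> f F \<le> f G)}"
  have hu_anti: "h (u F) \<le> h (u G)" if "F \<in> Fpow I" "G \<in> Fpow I" "G \<subseteq> F" for F G
    using that anti u_mem u_mono by (cases "G = F") auto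
  obtain f where f: "f \<in> \<G>" and f_min: "\<And>g. g \<in> \<G> \<Longrightarrow> g \<le> f \<Longrightarrow> g = f"
  proof (rule Zorn_Inf[of \<G>])
    have "(\<lambda>F. h (u F)) \<in> \<G>"
      using hu_anti mem u_mem by (auto simp: \<G>_def)
    then show "\<G> \<noteq> {}" by blast
    show "Inf \<C> \<in> \<G>" if sub: "\<C> \<subseteq> \<G>" and ne: "\<C> \<noteq> {}"
      and ch: "Complete_Partial_Order.chain (\<le>) \<C>" for \<C>
    proof -
      obtain f0 where f0: "f0 \<in> \<C>" using ne by blast
      have "(INF f\<in>\<C>. f F) \<in> \<H>" if "F \<in> Fpow I" for F
        using sub ne that
        by (intro Inf_closed chain_imageI[OF ch]) (auto simp: \<G>_def le_fun_def)
      moreover have "(INF f\<in>\<C>. f F) \<le> h (u F)" if "F \<in> Fpow I" for F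
        using sub f0 that by (intro INF_lower2[of f0]) (auto simp: \<G>_def)
      moreover have "(INF f\<in>\<C>. f F) \<le> (INF f\<in>\<C>. f G)"
        if "F \<in> Fpow I" "G \<in> Fpow I" "G \<subseteq> F" for F G
        using sub that by (intro INF_superset_mono) (auto simp: \<G>_def)
      ultimately show ?thesis
        by (simp add: \<G>_def Inf_apply)
    qed
  qed (use that in blast)
  have shift: "f (F \<union> E) = f F" if E: "E \<in> Fpow I" and F: "F \<in> Fpow I" for E F
  proof -
    \<comment> \<open>Outside \<open>Fpow I\<close> nothing is known about \<open>f\<close>, so
      \<open>g\<close> keeps its values there and \<open>g \<le> f\<close> holds for all
      arguments.\<close>
    define g where "g F = (if F \<in> Fpow I then f (F \<union> E) else f F)" for F
    have Un: "F \<union> E \<in> Fpow I" if "F \<in> Fpow I" for F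
      using that E by (auto simp: Fpow_def)
    have g_le: "f (F \<union> E) \<le> f F" if "F \<in> Fpow I" for F
      using f Un[OF that] that unfolding \<G>_def by blast
    have "g \<in> \<G>"
      unfolding \<G>_def
    proof (intro CollectI conjI ballI impI)
      fix F assume F: "F \<in> Fpow I"
      show "g F \<in> \<H>"
        using f F Un[OF F] by (simp add: \<G>_def g_def)
      show "g F \<le> h (u F)"
        using f F g_le[OF F] order_trans by (fastforce simp: \<G>_def g_def)
      fix G assume G: "G \<in> Fpow I" "G \<subseteq> F"
      then have "G \<union> E \<subseteq> F \<union> E" by blast
      then show "g F \<le> g G"
        using f F G Un[OF F] Un[OF G(1)] by (simp add: \<G>_def g_def)
    qed
    moreover have "g \<le> f"
      using g_le by (auto simp: le_fun_def g_def)
    ultimately have "g = f"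
      by (rule f_min)
    then show ?thesis
      using F by (metis g_def)
  qed
  show ?thesis
  proof (rule that[of "f {}"])
    show "f {} \<in> \<H>"
      using f by (simp add: \<G>_def empty_in_Fpow)
    fix i assume i: "i \<in> I"
    then have s: "{i} \<in> Fpow I"
      by (simp add: Fpow_def)
    \<comment> \<open>Shifting the argument \<open>{}\<close> by \<open>{i}\<close> leaves the value
      unchanged, so the one value \<open>f {}\<close> lies below every \<open>h i\<close>.\<close>
    have "f {} = f {i}"
      using shift[OF s empty_in_Fpow] by simp
    also have "\<dots> \<le> h (u {i})"
      using f s by (simp add: \<G>_def)
    also have "\<dots> \<le> h i"
      using anti u_mem u_ub s i by simp
    finally show "f {} \<le> h i" .
  qed
qed

subsection \<open>Admissible subsets of a bounded diversity\<close>

lemma diversity_subset: "diversity X \<delta> \<Longrightarrow> K \<subseteq> X \<Longrightarrow> diversity K \<delta>"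
  using Fpow_mono[of K X] unfolding diversity_def by (meson subsetD)

text \<open>\<open>M\<close> is a parameter rather than an existential so that it can serve as a
  value of the functions to which hyperconvexity is applied.\<close>

locale diversity_bounded_by =
  fixes X :: "'a set" and \<delta> :: "'a set \<Rightarrow> real" and M :: real
  assumes div: "diversity X \<delta>"
    and bound: "A \<in> Fpow X \<Longrightarrow> \<delta> A \<le> M"
begin

section \<open>Elementary estimates from the triangle inequality\<close>

lemma nonneg: "A \<in> Fpow X \<Longrightarrow> 0 \<le> \<delta> A"
  using div by (auto simp: diversity_def)

lemma eq_0_iff: "A \<in> Fpow X \<Longrightarrow> \<delta> A = 0 \<longleftrightarrow> card A \<le> 1"
  using div by (auto simp: diversity_def)

lemma empty [simp]: "\<delta> {} = 0"
  using eq_0_iff[of "{}"] by (simp add: empty_in_Fpow)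

lemma singleton: "x \<in> X \<Longrightarrow> \<delta> {x} = 0"
  using eq_0_iff[of "{x}"] by (simp add: Fpow_def)

lemma bound_nonneg: "0 \<le> M"
  using bound[of "{}"] by (simp add: empty_in_Fpow)

lemma triangle_through:
  assumes "A \<in> Fpow X" "C \<in> Fpow X" "x \<in> X"
  shows "\<delta> (A \<union> C) \<le> \<delta> (insert x A) + \<delta> (insert x C)"
proof -
  have "{x} \<in> Fpow X" using assms by (simp add: Fpow_def)
  then have "\<delta> (A \<union> C) \<le> \<delta> (A \<union> {x}) + \<delta> ({x} \<union> C)"
    using div assms unfolding diversity_def by blast
  then show ?thesis by simp
qed

lemma le_insert: "A \<in> Fpow X \<Longrightarrow> x \<in> X \<Longrightarrow> \<delta> A \<le> \<delta> (insert x A)"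
  using triangle_through[of A "{}" x] by (simp add: empty_in_Fpow singleton)

lemma Union_Fpow: "finite \<Y> \<Longrightarrow> \<Y> \<subseteq> Fpow K \<Longrightarrow> \<Union>\<Y> \<in> Fpow K"
  by (auto simp: Fpow_def)

lemma insert_Fpow: "Y \<in> Fpow K \<Longrightarrow> x \<in> K \<Longrightarrow> insert x Y \<in> Fpow K"
  by (auto simp: Fpow_def)

text \<open>All sets \<open>insert x Y\<close> share the point \<open>x\<close>, and the triangle
  inequality through \<open>x\<close> makes \<open>\<delta>\<close> subadditive on such
  sets.\<close>

lemma insert_Union_le:
  assumes "finite \<Y>" "\<Y> \<subseteq> Fpow X" "x \<in> X"
  shows "\<delta> (insert x (\<Union>\<Y>)) \<le> (\<Sum>Y\<in>\<Y>. \<delta> (insert x Y))"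
  using assms
proof (induction \<Y>)
  case (insert Y \<Y>)
  have "\<delta> (insert x (\<Union>(insert Y \<Y>))) = \<delta> (insert x Y \<union> insert x (\<Union>\<Y>))"
    by (rule arg_cong[of _ _ \<delta>]) auto
  also have "\<dots> \<le> \<delta> (insert x Y) + \<delta> (insert x (\<Union>\<Y>))"
    using triangle_through[of "insert x Y" "insert x (\<Union>\<Y>)" x] insert
    by (simp add: insert_Fpow Union_Fpow)
  finally show ?case
    using insert by auto
qed (simp add: singleton)

text \<open>Thus \<open>\<delta> (insert x Y)\<close>, as a function of \<open>Y\<close>, satisfies
  the condition on \<open>r\<close> in the definition of hyperconvexity.\<close>

lemma Union_le:
  assumes "finite \<Y>" "\<Y> \<subseteq> Fpow X" "x \<in> X"
  shows "\<delta> (\<Union>\<Y>) \<le> (\<Sum>Y\<in>\<Y>. \<delta> (insert x Y))"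
  using insert_Union_le[OF assms] le_insert[OF Union_Fpow[OF assms(1,2)] assms(3)] by linarith

text \<open>View \<open>Y\<close> as a star with center \<open>y\<close>: it is covered by the pairs
  \<open>{x, y}\<close>, one for each of the other \<open>card Y - 1\<close> points.\<close>

lemma le_card_diameter:
  assumes "Y \<in> Fpow X" "y \<in> Y" and D: "\<And>x. x \<in> Y \<Longrightarrow> \<delta> {x, y} \<le> D"
  shows "\<delta> Y \<le> (real (card Y) - 1) * D"
proof -
  have fin: "finite Y" and sub: "Y \<subseteq> X"
    using assms(1) by (auto simp: Fpow_def)
  have "\<delta> Y = \<delta> (insert y (\<Union>((\<lambda>x. {x}) ` (Y - {y}))))"
    using assms(2) by (intro arg_cong[of _ _ \<delta>]) auto
  also have "\<dots> \<le> (\<Sum>A\<in>(\<lambda>x. {x}) ` (Y - {y}). \<delta> (insert y A))"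
    using assms(2) fin sub by (intro insert_Union_le) (auto simp: Fpow_def)
  also have "\<dots> = (\<Sum>x\<in>Y - {y}. \<delta> {x, y})"
    by (subst sum.reindex) (auto simp: insert_commute)
  also have "\<dots> \<le> (\<Sum>x\<in>Y - {y}. D)"
    using D by (intro sum_mono) auto
  also have "\<dots> = (real (card Y) - 1) * D"
  proof -
    have "card Y \<ge> 1"
      using fin assms(2) by (auto simp: Suc_le_eq card_gt_0_iff)
    then show ?thesis
      using fin assms(2) by (simp add: of_nat_diff)
  qed
  finally show ?thesis .
qed

lemma hyperconvexD:
  assumes "hyperconvex_diversity K \<delta>" and "r {} = 0"
    and "\<And>\<Y>. finite \<Y> \<Longrightarrow> \<Y> \<subseteq> Fpow K \<Longrightarrow> \<delta> (\<Union>\<Y>) \<le> (\<Sum>Y\<in>\<Y>. r Y)"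
  obtains z where "z \<in> K" and "\<And>Y. Y \<in> Fpow K \<Longrightarrow> \<delta> (insert z Y) \<le> r Y"
proof -
  have "\<exists>z\<in>K. \<forall>Y\<in>Fpow K. \<delta> ({z} \<union> Y) \<le> r Y"
    using assms unfolding hyperconvex_diversity_def by blast
  then show ?thesis using that by auto
qed

lemma hyperconvex_nonempty:
  assumes "hyperconvex_diversity K \<delta>"
  shows "K \<noteq> {}"
proof
  assume "K = {}"
  then have "\<Union>\<Y> = {}" if "\<Y> \<subseteq> Fpow K" for \<Y>
    using that by (auto simp: Fpow_def)
  then obtain z where "z \<in> K"
    using hyperconvexD[OF assms, of "\<lambda>_. 0"] by (metis empty order_refl sum.neutral)
  with \<open>K = {}\<close> show False by simp
qed

text \<open>The intersections with \<open>K\<close> of sets of the form \<open>{z. \<delta> (insert z Y) \<le> t}\<close> with \<open>Y\<close> a finite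
  subset of \<open>K\<close>, described as the sets closed under the associated hull.\<close>

definition admissible :: "'a set \<Rightarrow> 'a set \<Rightarrow> bool" where
  "admissible K A \<longleftrightarrow> A \<subseteq> K \<and>
    (\<forall>z\<in>K. (\<forall>Y\<in>Fpow K. \<forall>t. (\<forall>a\<in>A. \<delta> (insert a Y) \<le> t) \<longrightarrow> \<delta> (insert z Y) \<le> t) \<longrightarrow> z \<in> A)"

lemma admissible_subset: "admissible K A \<Longrightarrow> A \<subseteq> K"
  by (simp add: admissible_def)

lemma admissible_self: "admissible K K"
  by (simp add: admissible_def)

text \<open>A bound valid on one \<open>A s\<close> is valid on the intersection, so the hull of the
  intersection lies in the hull of each \<open>A s\<close>.\<close>

lemma admissible_INT:
  assumes "\<And>s. s \<in> S \<Longrightarrow> admissible K (A s)" "S \<noteq> {}"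
  shows "admissible K (\<Inter>s\<in>S. A s)"
  unfolding admissible_def
proof (intro conjI ballI impI INT_I)
  show "(\<Inter>s\<in>S. A s) \<subseteq> K"
    using assms admissible_subset by blast
  fix z s
  assume z: "z \<in> K" and s: "s \<in> S" and hull: "\<forall>Y\<in>Fpow K. \<forall>t.
    (\<forall>a\<in>\<Inter>s\<in>S. A s. \<delta> (insert a Y) \<le> t) \<longrightarrow> \<delta> (insert z Y) \<le> t"
  have "\<delta> (insert z Y) \<le> t" if "Y \<in> Fpow K" "\<forall>a\<in>A s. \<delta> (insert a Y) \<le> t" for Y t
    using hull that s by (meson INT_D)
  then show "z \<in> A s"
    using assms(1)[OF s] z unfolding admissible_def by blast
qed

text \<open>Each pair in \<open>T\<close> is a bound that holds on the set cut out, hence it passes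
  to every point of the hull of that set.\<close>

lemma admissible_constraints:
  assumes "admissible K A" "\<And>Y t. (Y, t) \<in> T \<Longrightarrow> Y \<in> Fpow K"
  shows "admissible K {z \<in> A. \<forall>(Y, t)\<in>T. \<delta> (insert z Y) \<le> t}"
  unfolding admissible_def
proof (intro conjI ballI impI)
  show "{z \<in> A. \<forall>(Y, t)\<in>T. \<delta> (insert z Y) \<le> t} \<subseteq> K"
    using admissible_subset[OF assms(1)] by blast
  fix z assume z: "z \<in> K" and hull: "\<forall>Y\<in>Fpow K. \<forall>t.
    (\<forall>a\<in>{z \<in> A. \<forall>(Y, t)\<in>T. \<delta> (insert z Y) \<le> t}. \<delta> (insert a Y) \<le> t) \<longrightarrow> \<delta> (insert z Y) \<le> t"
  have "z \<in> A"
    using assms(1) z hull unfolding admissible_def by blast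
  moreover have "\<delta> (insert z Y) \<le> t" if "(Y, t) \<in> T" for Y t
    using hull assms(2)[OF that] that by blast
  ultimately show "z \<in> {z \<in> A. \<forall>(Y, t)\<in>T. \<delta> (insert z Y) \<le> t}"
    by blast
qed

text \<open>An asymptotic radius around \<open>Y\<close>: the infimum over the members
  \<open>A\<close> of the supremum of \<open>\<delta> (insert a Y)\<close> over \<open>a\<close> in
  \<open>A\<close>. For a single nonempty set it is that supremum.\<close>

definition radius :: "'a set set \<Rightarrow> 'a set \<Rightarrow> real" where
  "radius \<A> Y = Inf {t. \<exists>A\<in>\<A>. \<forall>a\<in>A. \<delta> (insert a Y) \<le> t}"

section \<open>Estimates for asymptotic radii\<close>

context
  fixes \<A> :: "'a set set" and K Y :: "'a set"
  assumes \<A>: "\<A> \<noteq> {}" "\<And>A. A \<in> \<A> \<Longrightarrow> A \<noteq> {}" "\<And>A. A \<in> \<A> \<Longrightarrow> A \<subseteq> X"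
    and Y: "Y \<in> Fpow X"
begin

lemma bound_in_radius_set: "M \<in> {t. \<exists>A\<in>\<A>. \<forall>a\<in>A. \<delta> (insert a Y) \<le> t}"
proof -
  obtain A where A: "A \<in> \<A>" using \<A>(1) by blast
  have "\<delta> (insert a Y) \<le> M" if "a \<in> A" for a
    using \<A>(3)[OF A] that by (intro bound insert_Fpow Y) auto
  then show ?thesis using A by blast
qed

lemma bdd_below_radius_set: "bdd_below {t. \<exists>A\<in>\<A>. \<forall>a\<in>A. \<delta> (insert a Y) \<le> t}"
proof (rule bdd_belowI)
  fix t assume "t \<in> {t. \<exists>A\<in>\<A>. \<forall>a\<in>A. \<delta> (insert a Y) \<le> t}"
  then obtain A where A: "A \<in> \<A>" "\<forall>a\<in>A. \<delta> (insert a Y) \<le> t"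
    by blast
  then obtain a where "a \<in> A" using \<A>(2) by blast
  then show "0 \<le> t"
    using A \<A>(3)[OF A(1)] nonneg[of "insert a Y"] insert_Fpow[OF Y] by fastforce
qed

lemma radius_le:
  assumes "A \<in> \<A>" "\<And>a. a \<in> A \<Longrightarrow> \<delta> (insert a Y) \<le> t"
  shows "radius \<A> Y \<le> t"
  unfolding radius_def using assms bdd_below_radius_set by (auto intro: cInf_lower)

lemma radius_less:
  assumes "radius \<A> Y < t"
  obtains A where "A \<in> \<A>" "\<And>a. a \<in> A \<Longrightarrow> \<delta> (insert a Y) \<le> t"
proof -
  obtain s where "s \<in> {t. \<exists>A\<in>\<A>. \<forall>a\<in>A. \<delta> (insert a Y) \<le> t}" "s < t"
    using cInf_lessD[OF _ assms[unfolded radius_def]] bound_in_radius_set by blast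
  then show ?thesis
    using that by fastforce
qed

end

lemma radius_singleton_ge:
  assumes "a \<in> A" "A \<subseteq> X" "Y \<in> Fpow X"
  shows "\<delta> (insert a Y) \<le> radius {A} Y"
proof (rule field_le_epsilon)
  fix e :: real assume "0 < e"
  then obtain B where "B \<in> {A}" "\<And>a. a \<in> B \<Longrightarrow> \<delta> (insert a Y) \<le> radius {A} Y + e"
    using radius_less[of "{A}" Y "radius {A} Y + e"] assms by auto
  then show "\<delta> (insert a Y) \<le> radius {A} Y + e"
    using assms(1) by blast
qed

lemma radius_empty:
  assumes "\<A> \<noteq> {}" "\<And>A. A \<in> \<A> \<Longrightarrow> A \<noteq> {}" "\<And>A. A \<in> \<A> \<Longrightarrow> A \<subseteq> X"
  shows "radius \<A> {} = 0"
proof -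
  have "(\<exists>A\<in>\<A>. \<forall>a\<in>A. \<delta> (insert a {}) \<le> t) \<longleftrightarrow> 0 \<le> t" for t
    using assms by (metis all_not_in_conv singleton subsetD)
  then have "{t. \<exists>A\<in>\<A>. \<forall>a\<in>A. \<delta> (insert a {}) \<le> t} = {0..}"
    by auto
  then show ?thesis
    by (simp add: radius_def)
qed

text \<open>Hyperconvexity of \<open>K\<close> is applied to \<open>radius \<A>\<close>. For
  finitely many \<open>Y\<close> a single member of the chain attains all the radii up to an error,
  and any of its points yields the required inequality.\<close>

lemma chain_admissible_Inter_nonempty:
  assumes K: "hyperconvex_diversity K \<delta>" "K \<subseteq> X"
    and \<A>: "\<A> \<noteq> {}" "\<And>A. A \<in> \<A> \<Longrightarrow> A \<noteq> {}" "\<And>A. A \<in> \<A> \<Longrightarrow> admissible K A"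
    and chain: "Complete_Partial_Order.chain (\<subseteq>) \<A>"
  shows "\<Inter>\<A> \<noteq> {}"
proof -
  have sub: "A \<subseteq> X" if "A \<in> \<A>" for A
    using admissible_subset \<A>(3)[OF that] K(2) by blast
  have FK: "Fpow K \<subseteq> Fpow X"
    using K(2) by (rule Fpow_mono)
  have approx: "\<exists>A\<in>\<A>. \<forall>Y\<in>\<Y>. \<forall>a\<in>A. \<delta> (insert a Y) \<le> radius \<A> Y + e"
    if "finite \<Y>" "\<Y> \<subseteq> Fpow X" "0 < e" for \<Y> e
    using that(1,2)
  proof (induction \<Y>)
    case empty
    then show ?case using \<A>(1) by auto
  next
    case (insert Y \<Y>)
    then obtain A where A: "A \<in> \<A>" "\<forall>Y\<in>\<Y>. \<forall>a\<in>A. \<delta> (insert a Y) \<le> radius \<A> Y + e"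
      by auto
    obtain B where B: "B \<in> \<A>" "\<And>a. a \<in> B \<Longrightarrow> \<delta> (insert a Y) \<le> radius \<A> Y + e"
      using radius_less[of \<A> Y "radius \<A> Y + e"] \<A>(1,2) sub insert.prems \<open>0 < e\<close> by auto
    from chainD[OF chain A(1) B(1)] show ?case
      using A B by (metis insert_iff subsetD)
  qed
  obtain z where z: "z \<in> K" "\<And>Y. Y \<in> Fpow K \<Longrightarrow> \<delta> (insert z Y) \<le> radius \<A> Y"
  proof (rule hyperconvexD[OF K(1), of "radius \<A>"])
    show "radius \<A> {} = 0"
      using \<A>(1,2) sub by (rule radius_empty)
    fix \<Y> assume \<Y>: "finite \<Y>" "\<Y> \<subseteq> Fpow K"
    show "\<delta> (\<Union>\<Y>) \<le> (\<Sum>Y\<in>\<Y>. radius \<A> Y)"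
    proof (rule field_le_epsilon)
      fix e :: real assume "0 < e"
      \<comment> \<open>The error is shared among the members of \<open>\<Y>\<close>; the added 1
        covers the empty family.\<close>
      define e' where "e' = e / (real (card \<Y>) + 1)"
      have e': "0 < e'" "real (card \<Y>) * e' \<le> e"
        using \<open>0 < e\<close> by (auto simp: e'_def field_simps)
      obtain A where A: "A \<in> \<A>" "\<forall>Y\<in>\<Y>. \<forall>a\<in>A. \<delta> (insert a Y) \<le> radius \<A> Y + e'"
        using approx[of \<Y> e'] \<Y> FK e'(1) by blast
      obtain a where a: "a \<in> A" using \<A>(2) A(1) by blast
      have "\<delta> (\<Union>\<Y>) \<le> (\<Sum>Y\<in>\<Y>. \<delta> (insert a Y))"
        using \<Y> FK a sub[OF A(1)] by (intro Union_le) auto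
      also have "\<dots> \<le> (\<Sum>Y\<in>\<Y>. radius \<A> Y + e')"
        using A a by (intro sum_mono) auto
      also have "\<dots> \<le> (\<Sum>Y\<in>\<Y>. radius \<A> Y) + e"
        using e'(2) by (simp add: sum.distrib)
      finally show "\<delta> (\<Union>\<Y>) \<le> (\<Sum>Y\<in>\<Y>. radius \<A> Y) + e" .
    qed
  qed (use that in blast)
  \<comment> \<open>Every bound valid on a member \<open>A\<close> is at least the radius, so
    \<open>z\<close> lies in the hull of \<open>A\<close>.\<close>
  have "z \<in> A" if "A \<in> \<A>" for A
  proof -
    have "\<delta> (insert z Y) \<le> t" if "Y \<in> Fpow K" "\<forall>a\<in>A. \<delta> (insert a Y) \<le> t" for Y t
      using z(2)[OF that(1)] radius_le[of \<A> Y A t] \<A>(1,2) sub that FK \<open>A \<in> \<A>\<close> by force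
    then show ?thesis
      using \<A>(3)[OF that] z(1) unfolding admissible_def by blast
  qed
  then show ?thesis by blast
qed

text \<open>A function \<open>r\<close> on \<open>Fpow A\<close> is extended to
  \<open>Fpow K\<close> so that the point supplied by \<open>K\<close> is forced into the hull of
  \<open>A\<close>, which is \<open>A\<close>.\<close>

lemma admissible_hyperconvex:
  assumes K: "hyperconvex_diversity K \<delta>" "K \<subseteq> X"
    and A: "admissible K A" "A \<noteq> {}"
  shows "hyperconvex_diversity A \<delta>"
  unfolding hyperconvex_diversity_def
proof (intro conjI allI impI; (elim conjE)?)
  have AK: "A \<subseteq> K" using A(1) by (rule admissible_subset)
  have AX: "A \<subseteq> X" using AK K(2) by blast
  have FA: "Fpow A \<subseteq> Fpow K" and FK: "Fpow K \<subseteq> Fpow X"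
    using AK K(2) by (simp_all add: Fpow_mono)
  show "diversity A \<delta>"
    using div AX by (rule diversity_subset)
  fix r :: "'a set \<Rightarrow> real"
  assume r0: "r {} = 0"
    and r: "\<forall>\<Y>. finite \<Y> \<and> \<Y> \<subseteq> Fpow A \<longrightarrow> \<delta> (\<Union>\<Y>) \<le> (\<Sum>Y\<in>\<Y>. r Y)"
  \<comment> \<open>On \<open>Fpow A\<close>, \<open>s\<close> is the minimum of \<open>r\<close>
    and the radius of \<open>A\<close>; elsewhere it is the radius. Being at most the radius puts
    \<open>z\<close> into \<open>A\<close>, and being at most \<open>r\<close> on
    \<open>Fpow A\<close> gives the required bound.\<close>
  define Q where "Q Y \<longleftrightarrow> Y \<in> Fpow A \<and> r Y \<le> radius {A} Y" for Y
  define s where "s Y = (if Q Y then r Y else radius {A} Y)" for Y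
  obtain z where z: "z \<in> K" "\<And>Y. Y \<in> Fpow K \<Longrightarrow> \<delta> (insert z Y) \<le> s Y"
  proof (rule hyperconvexD[OF K(1), of s])
    show "s {} = 0"
      using radius_empty[of "{A}"] A(2) AX r0 by (simp add: s_def)
    fix \<Y> assume \<Y>: "finite \<Y>" "\<Y> \<subseteq> Fpow K"
    define \<Q> where "\<Q> = {Y \<in> \<Y>. Q Y}"
    have \<Q>: "finite \<Q>" "\<Q> \<subseteq> Fpow A" "\<Q> \<subseteq> \<Y>"
      using \<Y> by (auto simp: \<Q>_def Q_def)
    \<comment> \<open>The sets with value \<open>r\<close> and those with value the radius are
      joined through \<open>a\<close>. Taken from \<open>\<Union>\<Q>\<close> if possible,
      \<open>a\<close> adds nothing to that union, so the hypothesis on \<open>r\<close> applies; if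
      the union is empty, only a singleton of value 0 arises.\<close>
    obtain a where a: "a \<in> A" "\<Union>\<Q> \<noteq> {} \<Longrightarrow> a \<in> \<Union>\<Q>"
      using A(2) \<Q>(2) by (cases "\<Union>\<Q> = {}") (auto simp: Fpow_def)
    have "\<delta> (insert a (\<Union>\<Q>)) = \<delta> (\<Union>\<Q>)"
    proof (cases "\<Union>\<Q> = {}")
      case True
      show ?thesis unfolding True using a(1) AX singleton by auto
    next
      case False
      from a(2)[OF this] show ?thesis by (simp only: insert_absorb)
    qed
    also have "\<dots> \<le> (\<Sum>Y\<in>\<Q>. r Y)"
      using r \<Q> by blast
    also have "\<dots> = (\<Sum>Y\<in>\<Q>. s Y)"
      by (intro sum.cong) (auto simp: s_def \<Q>_def)
    finally have 1: "\<delta> (insert a (\<Union>\<Q>)) \<le> (\<Sum>Y\<in>\<Q>. s Y)" .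
    have "\<delta> (insert a (\<Union>(\<Y> - \<Q>))) \<le> (\<Sum>Y\<in>\<Y> - \<Q>. \<delta> (insert a Y))"
      using \<Y> FK a AX by (intro insert_Union_le) auto
    also have "\<dots> \<le> (\<Sum>Y\<in>\<Y> - \<Q>. s Y)"
      using \<Y> FK a AX radius_singleton_ge[of a A] by (intro sum_mono) (auto simp: s_def \<Q>_def)
    finally have 2: "\<delta> (insert a (\<Union>(\<Y> - \<Q>))) \<le> (\<Sum>Y\<in>\<Y> - \<Q>. s Y)" .
    have "\<delta> (\<Union>\<Y>) = \<delta> (\<Union>\<Q> \<union> \<Union>(\<Y> - \<Q>))"
      using \<Q>(3) by (intro arg_cong[of _ _ \<delta>]) blast
    also have "\<dots> \<le> \<delta> (insert a (\<Union>\<Q>)) + \<delta> (insert a (\<Union>(\<Y> - \<Q>)))"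
      using \<Y> \<Q> FK FA a AX by (intro triangle_through Union_Fpow) auto
    also have "\<dots> \<le> (\<Sum>Y\<in>\<Y>. s Y)"
      using 1 2 sum.subset_diff[OF \<Q>(3) \<Y>(1), of s] by linarith
    finally show "\<delta> (\<Union>\<Y>) \<le> (\<Sum>Y\<in>\<Y>. s Y)" .
  qed (use that in blast)
  have s_le: "s Y \<le> radius {A} Y" for Y
    by (simp add: s_def Q_def)
  have "\<delta> (insert z Y) \<le> t" if "Y \<in> Fpow K" "\<forall>a\<in>A. \<delta> (insert a Y) \<le> t" for Y t
    using z(2)[OF that(1)] s_le[of Y] radius_le[of "{A}" Y A t] A(2) AX that FK by force
  then have "z \<in> A"
    using A(1) z(1) unfolding admissible_def by blast
  moreover have "\<delta> ({z} \<union> Y) \<le> r Y" if "Y \<in> Fpow A" for Y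
    using z(2)[of Y] that FA by (auto simp: s_def Q_def split: if_splits)
  ultimately show "\<exists>z\<in>A. \<forall>Y\<in>Fpow A. \<delta> ({z} \<union> Y) \<le> r Y"
    by blast
qed

text \<open>The induced metric need not be hyperconvex, so the factor one half is not available. A set of \<open>k\<close> points has
  \<open>\<delta>\<close>-value at most \<open>(k - 1) D\<close>, and at most \<open>M\<close>; both are at most \<open>k (1 - 1/N) D\<close>, the first if
  \<open>k \<le> N\<close>, the second if \<open>k > N\<close> and \<open>M \<le> (N - 1) D\<close>.\<close>

lemma exists_center:
  assumes K: "hyperconvex_diversity K \<delta>" "K \<subseteq> X"
    and D: "\<And>x y. x \<in> K \<Longrightarrow> y \<in> K \<Longrightarrow> \<delta> {x, y} \<le> D" "0 < D"
    and N: "M \<le> (real N - 1) * D" "0 < N"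
  obtains z where "z \<in> K" "\<And>y. y \<in> K \<Longrightarrow> \<delta> {z, y} \<le> (1 - 1 / real N) * D"
proof -
  define c where "c = (1 - 1 / real N) * D"
  have c: "0 \<le> c"
    using D N by (simp add: c_def)
  have FK: "Fpow K \<subseteq> Fpow X"
    using K(2) by (rule Fpow_mono)
  \<comment> \<open>Only the value \<open>c\<close> on singletons restricts \<open>z\<close>. The
    value \<open>M\<close> bounds \<open>\<delta>\<close> everywhere, so a family with a set of more
    than one point satisfies the hypothesis at once.\<close>
  define r where "r Y = (if card Y = 0 then 0 else if card Y = 1 then c else M)" for Y :: "'a set"
  have r_nonneg: "0 \<le> r Y" for Y
    using c bound_nonneg by (simp add: r_def)
  have card_le: "\<delta> Y \<le> real (card Y) * c" if Y: "Y \<in> Fpow K" "Y \<noteq> {}" for Y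
  proof (cases "card Y \<le> N")
    case True
    obtain y where y: "y \<in> Y" using Y by blast
    have "\<delta> Y \<le> (real (card Y) - 1) * D"
    proof (rule le_card_diameter[OF _ y])
      show "Y \<in> Fpow X" using Y(1) FK by blast
      show "\<delta> {x, y} \<le> D" if "x \<in> Y" for x
        using D(1)[of x y] Y(1) y that by (auto simp: Fpow_def)
    qed
    also have "\<dots> \<le> (real (card Y) * (1 - 1 / real N)) * D"
      using True N(2) D(2) by (intro mult_right_mono) (auto simp: field_simps)
    finally show ?thesis by (simp add: c_def mult.assoc)
  next
    case False
    have "\<delta> Y \<le> M" using bound Y FK by blast
    also have "\<dots> \<le> real N * c"
    proof -
      have "real N * c = (real N - 1) * D"
        using N(2) by (simp add: c_def field_simps)
      with N(1) show ?thesis by simp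
    qed
    also have "\<dots> \<le> real (card Y) * c"
      using False c by (intro mult_right_mono) auto
    finally show ?thesis .
  qed
  obtain z where z: "z \<in> K" "\<And>Y. Y \<in> Fpow K \<Longrightarrow> \<delta> (insert z Y) \<le> r Y"
  proof (rule hyperconvexD[OF K(1), of r])
    show "r {} = 0" by (simp add: r_def)
    fix \<Y> assume \<Y>: "finite \<Y>" "\<Y> \<subseteq> Fpow K"
    show "\<delta> (\<Union>\<Y>) \<le> (\<Sum>Y\<in>\<Y>. r Y)"
    proof (cases "\<exists>Y\<in>\<Y>. 1 < card Y")
      case True
      then obtain Y where Y: "Y \<in> \<Y>" "1 < card Y" by blast
      have "\<delta> (\<Union>\<Y>) \<le> M" using bound Union_Fpow[OF \<Y>] FK by blast
      also have "\<dots> = r Y" using Y by (simp add: r_def)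
      also have "\<dots> \<le> (\<Sum>Y\<in>\<Y>. r Y)"
        using Y \<Y> r_nonneg by (intro member_le_sum) auto
      finally show ?thesis .
    next
      case False
      \<comment> \<open>Without larger sets \<open>r\<close> is \<open>c\<close> times the
        cardinality, so \<open>card_le\<close> for the union suffices.\<close>
      have r_card: "r Y = real (card Y) * c" if "Y \<in> \<Y>" for Y
      proof -
        have "card Y = 0 \<or> card Y = 1" using False that by force
        then show ?thesis by (auto simp: r_def)
      qed
      have "\<delta> (\<Union>\<Y>) \<le> real (card (\<Union>\<Y>)) * c"
      proof (cases "\<Union>\<Y> = {}")
        case True
        show ?thesis unfolding True by simp
      next
        case False
        then show ?thesis by (rule card_le[OF Union_Fpow[OF \<Y>]])
      qed
      also have "\<dots> \<le> real (\<Sum>Y\<in>\<Y>. card Y) * c"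
        using c card_Union_le_sum_card[of \<Y>] by (intro mult_right_mono) (auto simp del: of_nat_sum)
      also have "\<dots> = (\<Sum>Y\<in>\<Y>. r Y)"
        by (simp add: sum_distrib_right r_card)
      finally show ?thesis .
    qed
  qed (use that in blast)
  show ?thesis
  proof (rule that[OF z(1)])
    fix y assume "y \<in> K"
    then show "\<delta> {z, y} \<le> (1 - 1 / real N) * D"
      using z(2)[of "{y}"] by (simp add: Fpow_def r_def c_def)
  qed
qed

subsection \<open>Chains of hyperconvex subsets\<close>

lemma chain_hyperconvex_Inter_nonempty:
  assumes ne: "\<C> \<noteq> {}" and chain: "Complete_Partial_Order.chain (\<subseteq>) \<C>"
    and hyp: "\<And>K. K \<in> \<C> \<Longrightarrow> hyperconvex_diversity K \<delta>"
    and sub: "\<And>K. K \<in> \<C> \<Longrightarrow> K \<subseteq> X"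
  shows "\<Inter>\<C> \<noteq> {}"
proof -
  define \<G> where "\<G> = {A. (\<forall>K\<in>\<C>. admissible K (A K) \<and> A K \<noteq> {}) \<and>
    (\<forall>J\<in>\<C>. \<forall>K\<in>\<C>. J \<subseteq> K \<longrightarrow> A J \<subseteq> A K)}"
  obtain A where A: "A \<in> \<G>" and A_min: "\<And>B. B \<in> \<G> \<Longrightarrow> B \<le> A \<Longrightarrow> B = A"
  proof (rule Zorn_Inf[of \<G>])
    have "K \<noteq> {}" if "K \<in> \<C>" for K
      using hyperconvex_nonempty hyp[OF that] by blast
    then have "(\<lambda>K. K) \<in> \<G>"
      by (auto simp: \<G>_def admissible_self)
    then show "\<G> \<noteq> {}" by blast
    show "Inf \<F> \<in> \<G>" if \<F>: "\<F> \<subseteq> \<G>" "\<F> \<noteq> {}"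
      and ch: "Complete_Partial_Order.chain (\<le>) \<F>" for \<F>
      unfolding \<G>_def
    proof (intro CollectI conjI ballI impI)
      fix K assume K: "K \<in> \<C>"
      have adm: "admissible K (B K)" "B K \<noteq> {}" if "B \<in> \<F>" for B
        using \<F>(1) K that by (auto simp: \<G>_def)
      show "admissible K (Inf \<F> K)"
        using admissible_INT[of \<F> K "\<lambda>B. B K"] adm \<F>(2) by (simp add: Inf_apply)
      show "Inf \<F> K \<noteq> {}"
        unfolding Inf_apply
      proof (rule chain_admissible_Inter_nonempty[OF hyp[OF K] sub[OF K]])
        show "Complete_Partial_Order.chain (\<subseteq>) ((\<lambda>B. B K) ` \<F>)"
          by (rule chain_imageI[OF ch]) (simp add: le_fun_def)
      qed (use adm \<F>(2) in auto)
    next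
      fix J K assume "J \<in> \<C>" "K \<in> \<C>" "J \<subseteq> K"
      then show "Inf \<F> J \<subseteq> Inf \<F> K"
        using \<F>(1) unfolding Inf_apply \<G>_def by (intro INF_superset_mono) blast+
    qed
  qed (use that in blast)
  have adm: "admissible K (A K)" "A K \<noteq> {}" if "K \<in> \<C>" for K
    using A that by (auto simp: \<G>_def)
  have mono: "A J \<subseteq> A K" if "J \<in> \<C>" "K \<in> \<C>" "J \<subseteq> K" for J K
    using A that by (auto simp: \<G>_def)
  have AX: "A K \<subseteq> K" "A K \<subseteq> X" if "K \<in> \<C>" for K
    using admissible_subset adm(1)[OF that] sub[OF that] by auto
  have center_extends: "\<delta> {z, y} \<le> t"
    if C: "C \<in> \<C>" "z \<in> C" "\<And>y. y \<in> A C \<Longrightarrow> \<delta> {z, y} \<le> t" and K: "K \<in> \<C>" "C \<subseteq> K" "y \<in> A K"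
    for C K z y t
  proof -
    \<comment> \<open>Cut \<open>A K\<close> by the ball of radius \<open>t\<close> around
      \<open>z\<close> for every \<open>K\<close> above \<open>C\<close>. The center lies in
      \<open>K\<close>, so the cut is admissible, and it contains \<open>A C\<close>, so it is
      nonempty; minimality then makes the cut ineffective.\<close>
    define B where "B K = (if K \<in> \<C> \<and> C \<subseteq> K
      then {y \<in> A K. \<forall>(Y, s)\<in>{({z}, t)}. \<delta> (insert y Y) \<le> s} else A K)" for K
    have A_C: "A C \<subseteq> B K" if "K \<in> \<C>" "C \<subseteq> K" for K
      using that mono[OF C(1)] C(3) by (auto simp: B_def insert_commute)
    have "B \<in> \<G>"
      unfolding \<G>_def
    proof (intro CollectI conjI ballI impI)
      fix K assume K: "K \<in> \<C>"
      show "admissible K (B K)"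
      proof (cases "C \<subseteq> K")
        case True
        then show ?thesis
          using K C(2) admissible_constraints[OF adm(1)[OF K], of "{({z}, t)}"]
          by (auto simp: B_def Fpow_def)
      qed (use adm(1)[OF K] in \<open>simp add: B_def\<close>)
      show "B K \<noteq> {}"
      proof (cases "C \<subseteq> K")
        case True
        then show ?thesis using A_C[OF K] adm(2)[OF C(1)] by blast
      qed (use adm(2)[OF K] in \<open>simp add: B_def\<close>)
    next
      fix J K assume JK: "J \<in> \<C>" "K \<in> \<C>" "J \<subseteq> K"
      show "B J \<subseteq> B K"
      proof (cases "C \<subseteq> J")
        case True
        then show ?thesis using mono[OF JK] JK by (auto simp: B_def)
      next
        case False
        \<comment> \<open>Below \<open>C\<close> nothing is cut, but there \<open>A J\<close> lies
          in \<open>A C\<close>, which survives every cut.\<close>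
        then have "J \<subseteq> C" using chainD[OF chain JK(1) C(1)] by blast
        then have "A J \<subseteq> A C" using mono JK C by blast
        then show ?thesis
          using A_C[OF JK(2)] mono[OF JK] False by (cases "C \<subseteq> K") (auto simp: B_def)
      qed
    qed
    moreover have "B \<le> A"
      by (auto simp: le_fun_def B_def)
    ultimately have "B = A" by (rule A_min)
    then have "y \<in> B K" using K by simp
    then show ?thesis
      using K by (simp add: B_def insert_commute)
  qed
  have diameter_le: "\<delta> {x, y} \<le> c"
    if centers: "\<And>K. K \<in> \<C> \<Longrightarrow> \<exists>z\<in>A K. \<forall>y\<in>A K. \<delta> {z, y} \<le> c"
      and K: "K \<in> \<C>" "x \<in> A K" "y \<in> A K" for K x y c
  proof -
    \<comment> \<open>Keep only the points of \<open>A K\<close> within \<open>c\<close> of all of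
      \<open>A K\<close>. By \<open>center_extends\<close> such a point for \<open>A J\<close> is
      also one for any larger \<open>A K\<close>, which gives monotonicity.\<close>
    define B where "B K = (if K \<in> \<C>
      then {z \<in> A K. \<forall>(Y, s)\<in>(\<lambda>y. ({y}, c)) ` A K. \<delta> (insert z Y) \<le> s} else A K)" for K
    have B: "z \<in> B K \<longleftrightarrow> z \<in> A K \<and> (\<forall>y\<in>A K. \<delta> {z, y} \<le> c)" if "K \<in> \<C>" for K z
      using that by (auto simp: B_def)
    have "B \<in> \<G>"
      unfolding \<G>_def
    proof (intro CollectI conjI ballI impI)
      fix K assume K: "K \<in> \<C>"
      show "admissible K (B K)"
        using K AX(1)[OF K] admissible_constraints[OF adm(1)[OF K], of "(\<lambda>y. ({y}, c)) ` A K"]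
        by (auto simp: B_def Fpow_def)
      show "B K \<noteq> {}"
        using B[OF K] centers[OF K] by blast
    next
      fix J K assume JK: "J \<in> \<C>" "K \<in> \<C>" "J \<subseteq> K"
      show "B J \<subseteq> B K"
      proof
        fix z assume "z \<in> B J"
        then have z: "z \<in> A J" "\<And>y. y \<in> A J \<Longrightarrow> \<delta> {z, y} \<le> c"
          using B[OF JK(1)] by auto
        have "\<delta> {z, y} \<le> c" if "y \<in> A K" for y
          using center_extends[OF JK(1) _ z(2) JK(2,3) that] AX(1)[OF JK(1)] z(1) by blast
        then show "z \<in> B K"
          using B[OF JK(2)] mono[OF JK] z(1) by blast
      qed
    qed
    moreover have "B \<le> A"
      by (auto simp: le_fun_def B_def)
    ultimately have "B = A" by (rule A_min)
    then show ?thesis using B K by blast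
  qed
  \<comment> \<open>One supremum is taken over the whole chain, so that the same \<open>c\<close>
    serves for every \<open>K\<close>.\<close>
  define S where "S = {\<delta> {x, y} | x y K. K \<in> \<C> \<and> x \<in> A K \<and> y \<in> A K}"
  have pair: "{x, y} \<in> Fpow X" if "K \<in> \<C>" "x \<in> A K" "y \<in> A K" for K x y
    using AX(2)[OF that(1)] that by (auto simp: Fpow_def)
  have "bdd_above S"
    unfolding S_def using bound[OF pair] by (intro bdd_aboveI[of _ M]) blast
  then have D: "\<delta> {x, y} \<le> Sup S" if "K \<in> \<C>" "x \<in> A K" "y \<in> A K" for K x y
    using that by (intro cSup_upper) (auto simp: S_def)
  have "S \<noteq> {}"
    using ne adm(2) unfolding S_def by fast
  have "Sup S \<le> 0"
  proof (rule ccontr)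
    assume "\<not> Sup S \<le> 0"
    then have pos: "0 < Sup S" by simp
    \<comment> \<open>The Archimedean property supplies \<open>N = Suc n\<close> for
      \<open>exists_center\<close>; the resulting \<open>c\<close> is strictly below
      \<open>Sup S\<close>.\<close>
    obtain n :: nat where "M < real n * Sup S"
      using reals_Archimedean3[OF pos] by blast
    then have N: "M \<le> (real (Suc n) - 1) * Sup S" by simp
    define c where "c = (1 - 1 / real (Suc n)) * Sup S"
    have "\<exists>z\<in>A K. \<forall>y\<in>A K. \<delta> {z, y} \<le> c" if K: "K \<in> \<C>" for K
    proof -
      have "hyperconvex_diversity (A K) \<delta>"
        by (rule admissible_hyperconvex[OF hyp[OF K] sub[OF K] adm[OF K]])
      from exists_center[OF this AX(2)[OF K] D[OF K] pos N zero_less_Suc] obtain z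
        where "z \<in> A K" "\<And>y. y \<in> A K \<Longrightarrow> \<delta> {z, y} \<le> c"
        unfolding c_def by blast
      then show ?thesis by blast
    qed
    from diameter_le[OF this] have "s \<le> c" if "s \<in> S" for s
      using that unfolding S_def by blast
    with \<open>S \<noteq> {}\<close> have "Sup S \<le> c"
      by (rule cSup_least)
    also have "c < Sup S"
      using pos by (simp add: c_def field_simps)
    finally show False by simp
  qed
  then have unique: "x = y" if K: "K \<in> \<C>" "x \<in> A K" "y \<in> A K" for K x y
  proof -
    note F = pair[OF K]
    have "\<delta> {x, y} = 0"
      using D[OF K] nonneg[OF F] \<open>Sup S \<le> 0\<close> by linarith
    then show ?thesis
      using eq_0_iff[OF F] by (cases "x = y") auto
  qed
  obtain C where C: "C \<in> \<C>" using ne by blast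
  obtain x where x: "x \<in> A C" using adm(2)[OF C] by blast
  have "x \<in> K" if K: "K \<in> \<C>" for K
  proof -
    obtain y where y: "y \<in> A K" using adm(2)[OF K] by blast
    \<comment> \<open>Two members of the chain are comparable, so their one-point sets are nested
      and hence equal.\<close>
    have "x = y"
      using chainD[OF chain C K] mono[OF C K] mono[OF K C] unique[OF C] unique[OF K] x y by blast
    then show ?thesis using y AX(1)[OF K] by blast
  qed
  then show ?thesis by blast
qed

text \<open>Given \<open>r\<close> on \<open>Fpow (\<Inter>\<C>)\<close>, cut each \<open>K\<close>
  down to the points obeying all bounds from \<open>r\<close>. The cuts form a chain of hyperconvex
  sets, and a common point of them is the point sought.\<close>

lemma chain_hyperconvex_Inter:
  assumes ne: "\<C> \<noteq> {}" and chain: "Complete_Partial_Order.chain (\<subseteq>) \<C>"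
    and hyp: "\<And>K. K \<in> \<C> \<Longrightarrow> hyperconvex_diversity K \<delta>"
    and sub: "\<And>K. K \<in> \<C> \<Longrightarrow> K \<subseteq> X"
  shows "hyperconvex_diversity (\<Inter>\<C>) \<delta>"
  unfolding hyperconvex_diversity_def
proof (intro conjI allI impI; (elim conjE)?)
  have L: "\<Inter>\<C> \<subseteq> X" using ne sub by blast
  have FL: "Fpow (\<Inter>\<C>) \<subseteq> Fpow K" if "K \<in> \<C>" for K
    using that by (intro Fpow_mono) blast
  show "diversity (\<Inter>\<C>) \<delta>"
    using div L by (rule diversity_subset)
  fix r :: "'a set \<Rightarrow> real"
  assume r0: "r {} = 0"
    and r: "\<forall>\<Y>. finite \<Y> \<and> \<Y> \<subseteq> Fpow (\<Inter>\<C>) \<longrightarrow> \<delta> (\<Union>\<Y>) \<le> (\<Sum>Y\<in>\<Y>. r Y)"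
  have r_nonneg: "0 \<le> r Y" if "Y \<in> Fpow (\<Inter>\<C>)" for Y
    using r[rule_format, of "{Y}"] that nonneg[of Y] Fpow_mono[OF L] by force
  define T where "T = (\<lambda>Y. (Y, r Y)) ` Fpow (\<Inter>\<C>)"
  define B where "B K = {z \<in> K. \<forall>(Y, t)\<in>T. \<delta> (insert z Y) \<le> t}" for K
  have hyp_B: "hyperconvex_diversity (B K) \<delta>" if K: "K \<in> \<C>" for K
  proof (rule admissible_hyperconvex[OF hyp[OF K] sub[OF K]])
    show "admissible K (B K)"
      unfolding B_def using FL[OF K]
      by (intro admissible_constraints admissible_self) (auto simp: T_def)
    \<comment> \<open>Extending \<open>r\<close> by \<open>M\<close> preserves the hypothesis of
      hyperconvexity: a family with a set outside \<open>Fpow (\<Inter>\<C>)\<close> already has sum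
      at least \<open>M\<close>, as all values are nonnegative.\<close>
    define s where "s Y = (if Y \<in> Fpow (\<Inter>\<C>) then r Y else M)" for Y
    obtain z where z: "z \<in> K" "\<And>Y. Y \<in> Fpow K \<Longrightarrow> \<delta> (insert z Y) \<le> s Y"
    proof (rule hyperconvexD[OF hyp[OF K], of s])
      show "s {} = 0" by (simp add: s_def r0 empty_in_Fpow)
      fix \<Y> assume \<Y>: "finite \<Y>" "\<Y> \<subseteq> Fpow K"
      show "\<delta> (\<Union>\<Y>) \<le> (\<Sum>Y\<in>\<Y>. s Y)"
      proof (cases "\<Y> \<subseteq> Fpow (\<Inter>\<C>)")
        case True
        then have "\<delta> (\<Union>\<Y>) \<le> (\<Sum>Y\<in>\<Y>. r Y)" using r \<Y> by blast
        also have "\<dots> = (\<Sum>Y\<in>\<Y>. s Y)"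
          using True by (intro sum.cong) (auto simp: s_def)
        finally show ?thesis .
      next
        case False
        then obtain Y where Y: "Y \<in> \<Y>" "Y \<notin> Fpow (\<Inter>\<C>)" by blast
        have "\<delta> (\<Union>\<Y>) \<le> M"
          using bound Union_Fpow[OF \<Y>] Fpow_mono[OF sub[OF K]] by blast
        also have "\<dots> = s Y" using Y by (simp add: s_def)
        also have "\<dots> \<le> (\<Sum>Y\<in>\<Y>. s Y)"
          using Y \<Y> r_nonneg bound_nonneg by (intro member_le_sum) (auto simp: s_def)
        finally show ?thesis .
      qed
    qed (use that in blast)
    have "z \<in> B K"
      using z FL[OF K] by (force simp: B_def T_def s_def)
    then show "B K \<noteq> {}" by blast
  qed
  have "\<Inter>(B ` \<C>) \<noteq> {}"
  proof (rule chain_hyperconvex_Inter_nonempty)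
    show "Complete_Partial_Order.chain (\<subseteq>) (B ` \<C>)"
      by (rule chain_imageI[OF chain]) (auto simp: B_def)
  qed (use ne hyp_B sub in \<open>auto simp: B_def\<close>)
  then obtain z where "\<And>K. K \<in> \<C> \<Longrightarrow> z \<in> B K" by auto
  then have "z \<in> \<Inter>\<C>" "\<forall>Y\<in>Fpow (\<Inter>\<C>). \<delta> ({z} \<union> Y) \<le> r Y"
    using ne by (auto simp: B_def T_def)
  then show "\<exists>z\<in>\<Inter>\<C>. \<forall>Y\<in>Fpow (\<Inter>\<C>). \<delta> ({z} \<union> Y) \<le> r Y"
    by blast
qed

end

theorem theorem4p6:
  fixes X :: "'a set" and \<delta> :: "'a set \<Rightarrow> real"
    and I :: "'i set" and le :: "'i \<Rightarrow> 'i \<Rightarrow> bool" and H :: "'i \<Rightarrow> 'a set"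
  assumes "bounded_diversity X \<delta>"
    and "hyperconvex_diversity X \<delta>"
    and "directed_set I le"
    and "\<And>i. i \<in> I \<Longrightarrow> H i \<subseteq> X"
    and "\<And>i j. i \<in> I \<Longrightarrow> j \<in> I \<Longrightarrow> le j i \<Longrightarrow> H i \<subseteq> H j"
    and "\<And>i. i \<in> I \<Longrightarrow> hyperconvex_diversity (H i) \<delta>"
  shows "(\<Inter>i\<in>I. H i) \<noteq> {}"
proof -
  obtain M where "diversity_bounded_by X \<delta> M"
    using assms(1) by (auto simp: bounded_diversity_def diversity_bounded_by_def)
  then interpret diversity_bounded_by X \<delta> M .
  \<comment> \<open>A lower bound of the family inside \<open>\<H>\<close> is itself hyperconvex,
    hence nonempty, and it lies in every \<open>H i\<close>.\<close>
  define \<H> where "\<H> = {K. K \<subseteq> X \<and> hyperconvex_diversity K \<delta>}"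
  obtain A where "A \<in> \<H>" and A: "\<And>i. i \<in> I \<Longrightarrow> A \<subseteq> H i"
  proof (rule directed_lower_bound[of \<H> I le H])
    show "\<Inter>\<C> \<in> \<H>" if "\<C> \<subseteq> \<H>" "\<C> \<noteq> {}" "Complete_Partial_Order.chain (\<subseteq>) \<C>" for \<C>
      using chain_hyperconvex_Inter[of \<C>] that by (auto simp: \<H>_def)
  qed (use assms that in \<open>auto simp: \<H>_def\<close>)
  then have "A \<noteq> {}"
    using hyperconvex_nonempty by (simp add: \<H>_def)
  with A show ?thesis by blast
qed

end
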